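(* Let $D\subset\mathbb{R}^n$ be an open and convex set and let $S\subset D$ be a simplex with vertices $v_0,\dots,v_n$ and barycenter $\mathbf{b}$. If $f:D\to\mathbb{R}$ is W-convex, then \[ (n+1)f(\mathbf{b}) \leq \frac{1}{|S|} \int_S \Bigl( \sum_{\sigma \in C}f_{\sigma}(x) \Bigr)\,\mathrm{d}x \leq \sum_{i=0}^n f(v_i). \]
   Context: A function $f:D\to\mathbb{R}$ on a convex set $D\subset\mathbb{R}^n$ is W-convex (Wright-convex) if $f(tx+(1-t)y)+f((1-t)x+ty)\le f(x)+f(y)$ for all $x,y\in D$ and $t\in[0,1]$. A simplex with vertices $v_0,\dots,v_n\in\mathbb{R}^n$ is $S=\mathrm{conv}\{v_0,\dots,v_n\}$ where $v_0,\dots,v_n$ are affinely independent; $|S|$ denotes its volume and $\mathbf{b}=\frac{1}{n+1}\sum_{i=0}^n v_i$ its barycenter. $C$ is the set of all cyclic permutations of $\{0,\dots,n\}$, i.e. the $n+1$ shifts $i\mapsto i+k \pmod{n+1}$, $k=0,\dots,n$. Every $x\in\mathbb{R}^n$ is uniquely $x=\sum_{i=0}^n t_iv_i$ with real $t_i$ summing to $1$, and each $\sigma\in C$ is identified with the affine map $\sigma:\mathbb{R}^n\to\mathbb{R}^n$, $\sigma\bigl(\sum_{i=0}^n t_iv_i\bigr)=\sum_{i=0}^n t_{\sigma(i)}v_i$ (which maps $S$ to $S$). For a real function $f$ defined on $S$ (or on a set containing $S$), $f_\sigma:S\to\mathbb{R}$ is defined by $f_\sigma(x)=f(\sigma(x))$.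 *)

theory Defs
  imports "HOL-Analysis.Analysis" "HOL-Number_Theory.Cong"
begin

definition W_convex_on :: "'a::real_vector set \<Rightarrow> ('a \<Rightarrow> real) \<Rightarrow> bool" where
  "W_convex_on D f \<longleftrightarrow> convex D \<and>
     (\<forall>x\<in>D. \<forall>y\<in>D. \<forall>t\<in>{0..1}.
        f (t *\<^sub>R x + (1 - t) *\<^sub>R y) + f ((1 - t) *\<^sub>R x + t *\<^sub>R y) \<le> f x + f y)"

text \<open>
  A system of points \<open>v 0, \<dots>, v n\<close> is a function \<open>v\<close> on \<open>nat\<close> of which only the
  values at the indices \<open>{..n}\<close> matter. The library predicate \<^const>\<open>affine_dependent\<close> is about
  sets, so affine independence of the family also requires the points to be distinct.
\<close>

definition affinely_independent :: "nat \<Rightarrow> (nat \<Rightarrow> 'a::real_vector) \<Rightarrow> bool" where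
  "affinely_independent n v \<longleftrightarrow> inj_on v {..n} \<and> \<not> affine_dependent (v ` {..n})"

definition barycenter :: "nat \<Rightarrow> (nat \<Rightarrow> 'a::real_vector) \<Rightarrow> 'a" where
  "barycenter n v = (1 / (real n + 1)) *\<^sub>R (\<Sum>i\<le>n. v i)"

text \<open>
  The coefficients are only determined at the indices \<open>{..n}\<close>; \<^const>\<open>extensional\<close> fixes the
  irrelevant values, so that \<open>THE\<close> picks a unique function.
\<close>

definition bary_coords :: "nat \<Rightarrow> (nat \<Rightarrow> 'a::real_vector) \<Rightarrow> 'a \<Rightarrow> nat \<Rightarrow> real" where
  "bary_coords n v x =
     (THE t. t \<in> extensional {..n} \<and> (\<Sum>i\<le>n. t i) = 1 \<and> x = (\<Sum>i\<le>n. t i *\<^sub>R v i))"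

definition shift :: "nat \<Rightarrow> nat \<Rightarrow> nat \<Rightarrow> nat" where
  "shift n k i = (if i \<le> n then (i + k) mod (n + 1) else i)"

definition cyclic_perms :: "nat \<Rightarrow> (nat \<Rightarrow> nat) set" where
  "cyclic_perms n = shift n ` {..n}"

definition perm_map ::
    "nat \<Rightarrow> (nat \<Rightarrow> 'a::real_vector) \<Rightarrow> (nat \<Rightarrow> nat) \<Rightarrow> 'a \<Rightarrow> 'a" where
  "perm_map n v \<sigma> x = (\<Sum>i\<le>n. bary_coords n v x (\<sigma> i) *\<^sub>R v i)"

lemma bary_coords_unique:
  fixes v :: "nat \<Rightarrow> 'a::real_vector"
  assumes "affinely_independent n v"
    and "(\<Sum>i\<le>n. s i) = 1" "(\<Sum>i\<le>n. t i) = 1"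
    and "(\<Sum>i\<le>n. s i *\<^sub>R v i) = (\<Sum>i\<le>n. t i *\<^sub>R v i)" and "i \<le> n"
  shows "s i = t i"
proof (rule ccontr)
  assume ne: "s i \<noteq> t i"
  have inj: "inj_on v {..n}" and ind: "\<not> affine_dependent (v ` {..n})"
    using assms(1) by (auto simp: affinely_independent_def)
  define U where "U = (\<lambda>w. let j = the_inv_into {..n} v w in s j - t j)"
  have U: "U (v j) = s j - t j" if "j \<le> n" for j
    using that inj by (simp add: U_def the_inv_into_f_f)
  have "sum U (v ` {..n}) = 0"
    using assms(2,3) by (simp add: sum.reindex[OF inj] U sum_subtractf)
  moreover have "(\<Sum>w\<in>v ` {..n}. U w *\<^sub>R w) = 0"
    using assms(4) by (simp add: sum.reindex[OF inj] U sum_subtractf scaleR_diff_left)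
  moreover have "\<exists>w\<in>v ` {..n}. U w \<noteq> 0"
    using ne U[OF assms(5)] assms(5) by (intro bexI[of _ "v i"]) auto
  ultimately show False
    using ind by (auto simp: affine_dependent_explicit_finite)
qed

lemma bary_coords_sum:
  fixes v :: "nat \<Rightarrow> 'a::real_vector"
  assumes "affinely_independent n v" and "(\<Sum>i\<le>n. t i) = 1" and "i \<le> n"
  shows "bary_coords n v (\<Sum>i\<le>n. t i *\<^sub>R v i) i = t i"
proof -
  let ?P = "\<lambda>s. s \<in> extensional {..n} \<and> (\<Sum>i\<le>n. s i) = 1 \<and>
    (\<Sum>i\<le>n. t i *\<^sub>R v i) = (\<Sum>i\<le>n. s i *\<^sub>R v i)"
  have "(THE s. ?P s) = restrict t {..n}"
  proof (rule the_equality)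
    show "?P (restrict t {..n})" using assms(2) by simp
    show "s = restrict t {..n}" if "?P s" for s
    proof (rule extensionalityI)
      show "s \<in> extensional {..n}" using that by blast
      show "s j = restrict t {..n} j" if "j \<in> {..n}" for j
        using bary_coords_unique[OF assms(1), of s t j] that \<open>?P s\<close> assms(2) by simp
    qed simp
  qed
  then show ?thesis using assms(3) by (simp add: bary_coords_def)
qed

lemma bary_coords_exist:
  fixes v :: "nat \<Rightarrow> real ^ 'n"
  assumes "affinely_independent CARD('n) v"
  obtains t where "(\<Sum>i\<le>CARD('n). t i) = 1" "x = (\<Sum>i\<le>CARD('n). t i *\<^sub>R v i)"
proof -
  let ?n = "CARD('n)"
  have inj: "inj_on v {..?n}" and ind: "\<not> affine_dependent (v ` {..?n})"
    using assms by (auto simp: affinely_independent_def)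
  have "card (v ` {..?n}) = Suc ?n" using inj by (simp add: card_image)
  then have "affine hull (v ` {..?n}) = UNIV"
    using affine_independent_span_gt[OF ind] by simp
  then have "x \<in> affine hull (v ` {..?n})" by simp
  then obtain u where "sum u (v ` {..?n}) = 1" "(\<Sum>w\<in>v ` {..?n}. u w *\<^sub>R w) = x"
    by (auto simp: affine_hull_finite)
  then show thesis
    by (intro that[of "u \<circ> v"]) (simp_all add: sum.reindex[OF inj])
qed

lemma shift_permutes:
  assumes "\<sigma> \<in> cyclic_perms n"
  shows "bij_betw \<sigma> {..n} {..n}"
proof -
  obtain k where k: "\<sigma> = shift n k" using assms by (auto simp: cyclic_perms_def)
  have "inj_on (shift n k) {..n}"
  proof (rule inj_onI)
    fix i j assume ij: "i \<in> {..n}" "j \<in> {..n}" "shift n k i = shift n k j"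
    then have "(i + k) mod (n + 1) = (j + k) mod (n + 1)" by (simp add: shift_def)
    then have "i mod (n + 1) = j mod (n + 1)"
      using cong_add_rcancel_nat[of i k j "n + 1"] by (simp add: cong_def)
    with ij show "i = j" by simp
  qed
  moreover have "shift n k ` {..n} \<subseteq> {..n}"
    by (auto simp: shift_def less_Suc_eq_le[symmetric])
  ultimately show ?thesis
    unfolding k bij_betw_def using endo_inj_surj[of "{..n}"] by blast
qed

lemma perm_map_sum:
  fixes v :: "nat \<Rightarrow> 'a::real_vector"
  assumes "affinely_independent n v" and "(\<Sum>i\<le>n. t i) = 1" and "\<sigma> \<in> cyclic_perms n"
  shows "perm_map n v \<sigma> (\<Sum>i\<le>n. t i *\<^sub>R v i) = (\<Sum>i\<le>n. t (\<sigma> i) *\<^sub>R v i)"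
proof -
  have "\<sigma> i \<le> n" if "i \<le> n" for i
    using bij_betwE[OF shift_permutes[OF assms(3)]] that by auto
  then show ?thesis
    by (simp add: perm_map_def bary_coords_sum[OF assms(1,2)])
qed

end

theory Submission
  imports Defs
begin

text \<open>
  Put \<open>F x = (\<Sum>\<sigma>\<in>cyclic_perms n. f (perm_map n v \<sigma> x))\<close>. Both inequalities already hold pointwise,
  before averaging: \<open>(n + 1) f(b) \<le> F x \<le> \<Sum>i. f (v i)\<close> for every \<open>x\<close> in the simplex.

  The lower bound is Jensen's inequality with equal weights, which needs only midpoint convexity of
  \<open>f\<close>: the \<open>n + 1\<close> cyclic images of \<open>x\<close> have mean \<open>b\<close>, because each coordinate of \<open>x\<close> visits
  each vertex exactly once (\<open>sum_perm_map\<close>).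

  For the upper bound and for integrability, the point is that \<open>F\<close> is convex and continuous although
  \<open>f\<close> itself may be wildly discontinuous (an additive function is W-convex). One can see this from
  Ng's theorem, by which \<open>f\<close> is the sum of an additive and a convex function: the additive part
  contributes a constant to \<open>F\<close>. The proof here bypasses that theorem. \<open>F\<close> is W-convex,
  and by Jensen's inequality it is bounded below. A W-convex function that is bounded below is
  bounded above on every segment, since the two values on the left of the W-convexity
  inequality then bound each other; and a midpoint convex function bounded above on segments is
  convex (\<open>convex_on_if_W_convex_on_bounded_below\<close>). Finally, \<open>F\<close> takes the same value
  \<open>\<Sum>i. f (v i)\<close> at all the vertices, so convexity gives the upper bound on all of the simplex.
\<close>

section \<open>W-convex functions\<close>

lemma W_convex_on_midpoint:
  assumes "W_convex_on D f" "x \<in> D" "y \<in> D"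
  shows "2 * f ((1/2) *\<^sub>R x + (1/2) *\<^sub>R y) \<le> f x + f y"
proof -
  have "\<forall>t\<in>{0..1}. f (t *\<^sub>R x + (1 - t) *\<^sub>R y) + f ((1 - t) *\<^sub>R x + t *\<^sub>R y) \<le> f x + f y"
    using assms by (simp add: W_convex_on_def)
  from bspec[OF this, of "1/2"] show ?thesis by simp
qed

text \<open>
  Cauchy's argument: halving a sum gives the inequality for \<open>2 ^ k\<close> points, and adjoining to
  \<open>m\<close> points their own mean deduces the case of \<open>m\<close> points from that of \<open>m + 1\<close> points.
\<close>

lemma W_convex_on_Jensen_power_two:
  fixes y :: "nat \<Rightarrow> 'a::real_vector"
  assumes W: "W_convex_on D f" and "\<And>i. i < 2 ^ k \<Longrightarrow> y i \<in> D"
  shows "2 ^ k * f ((1 / 2 ^ k) *\<^sub>R (\<Sum>i<2 ^ k. y i)) \<le> (\<Sum>i<2 ^ k. f (y i))"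
  using assms(2)
proof (induction k arbitrary: y)
  case 0
  then show ?case by simp
next
  case (Suc k)
  let ?N = "2 ^ k :: nat"
  define z where "z i = y (i + ?N)" for i
  define a where "a = (1 / 2 ^ k) *\<^sub>R (\<Sum>i<?N. y i)"
  define c where "c = (1 / 2 ^ k) *\<^sub>R (\<Sum>i<?N. z i)"
  have split: "(\<Sum>i<2 ^ Suc k. g (y i)) = (\<Sum>i<?N. g (y i)) + (\<Sum>i<?N. g (z i))"
    for g :: "'a \<Rightarrow> 'b::comm_monoid_add"
  proof -
    have "(\<Sum>i<?N + ?N. g (y i)) = (\<Sum>i<?N. g (y i)) + (\<Sum>i\<in>{?N..<?N + ?N}. g (y i))"
      by (simp add: lessThan_atLeast0 sum.atLeastLessThan_concat)
    also have "(\<Sum>i\<in>{?N..<?N + ?N}. g (y i)) = (\<Sum>i<?N. g (z i))"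
      using sum.shift_bounds_nat_ivl[of "\<lambda>i. g (y i)" 0 ?N ?N]
      by (simp add: z_def lessThan_atLeast0)
    finally show ?thesis by (simp add: mult_2)
  qed
  have yD: "y i \<in> D" "z i \<in> D" if "i < ?N" for i
    using that by (auto simp: z_def intro!: Suc.prems)
  have conv: "convex D" using W by (simp add: W_convex_on_def)
  have aD: "a \<in> D" "c \<in> D"
    using convex_sum[of "{..<?N}" D "\<lambda>_. 1 / 2 ^ k" y] convex_sum[of "{..<?N}" D "\<lambda>_. 1 / 2 ^ k" z]
      conv yD
    by (auto simp: a_def c_def scaleR_sum_right)
  have "(1 / 2 ^ Suc k) *\<^sub>R (\<Sum>i<2 ^ Suc k. y i) = (1/2) *\<^sub>R a + (1/2) *\<^sub>R c"
    using split[of "\<lambda>x. x"] by (simp add: a_def c_def scaleR_add_right)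
  moreover have "2 ^ k * (2 * f ((1/2) *\<^sub>R a + (1/2) *\<^sub>R c)) \<le> 2 ^ k * (f a + f c)"
    using W_convex_on_midpoint[OF W aD] by (intro mult_left_mono) auto
  moreover have "2 ^ k * f a \<le> (\<Sum>i<?N. f (y i))" "2 ^ k * f c \<le> (\<Sum>i<?N. f (z i))"
    unfolding a_def c_def using yD by (intro Suc.IH; blast)+
  ultimately show ?case
    using split[of f] by (simp add: algebra_simps)
qed

lemma W_convex_on_Jensen_nat:
  fixes y :: "nat \<Rightarrow> 'a::real_vector"
  assumes W: "W_convex_on D f" and "0 < m" and "\<And>i. i < m \<Longrightarrow> y i \<in> D"
  shows "real m * f ((1 / real m) *\<^sub>R (\<Sum>i<m. y i)) \<le> (\<Sum>i<m. f (y i))"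
proof -
  have "m \<le> 2 ^ m" by (simp add: less_imp_le)
  then show ?thesis using assms(2,3)
  proof (induction m arbitrary: y rule: inc_induct)
    case base
    then show ?case using W_convex_on_Jensen_power_two[OF W, of m y] by simp
  next
    case (step m)
    define \<mu> where "\<mu> = (1 / real m) *\<^sub>R (\<Sum>i<m. y i)"
    define y' where "y' = y(m := \<mu>)"
    have "convex D" using W by (simp add: W_convex_on_def)
    then have "\<mu> \<in> D"
      using convex_sum[of "{..<m}" D "\<lambda>_. 1 / real m" y] step.prems
      by (auto simp: \<mu>_def scaleR_sum_right)
    then have "y' i \<in> D" if "i < Suc m" for i
      using that step.prems by (auto simp: y'_def less_Suc_eq)
    then have "real (Suc m) * f ((1 / real (Suc m)) *\<^sub>R (\<Sum>i<Suc m. y' i)) \<le> (\<Sum>i<Suc m. f (y' i))"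
      by (intro step.IH) auto
    moreover have "(\<Sum>i<m. y' i) = (\<Sum>i<m. y i)" "(\<Sum>i<m. f (y' i)) = (\<Sum>i<m. f (y i))"
      by (auto simp: y'_def)
    moreover have "(\<Sum>i<m. y i) + \<mu> = real (Suc m) *\<^sub>R \<mu>"
    proof -
      have "(\<Sum>i<m. y i) = real m *\<^sub>R \<mu>" using step.prems by (simp add: \<mu>_def)
      then show ?thesis by (simp add: scaleR_add_left)
    qed
    ultimately have "real (Suc m) * f \<mu> \<le> (\<Sum>i<m. f (y i)) + f \<mu>"
      by (simp add: y'_def del: of_nat_Suc)
    then show ?case by (simp add: \<mu>_def algebra_simps)
  qed
qed

lemma W_convex_on_Jensen:
  assumes W: "W_convex_on D f" and "finite I" "I \<noteq> {}" and y: "\<And>i. i \<in> I \<Longrightarrow> y i \<in> D"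
  shows "real (card I) * f ((1 / real (card I)) *\<^sub>R (\<Sum>i\<in>I. y i)) \<le> (\<Sum>i\<in>I. f (y i))"
proof -
  obtain h where h: "bij_betw h {..<card I} I"
    using ex_bij_betw_nat_finite[OF \<open>finite I\<close>] by (auto simp: lessThan_atLeast0)
  have "real (card I) * f ((1 / real (card I)) *\<^sub>R (\<Sum>i<card I. y (h i))) \<le> (\<Sum>i<card I. f (y (h i)))"
    using assms bij_betwE[OF h] by (intro W_convex_on_Jensen_nat[OF W]) (auto simp: card_gt_0_iff)
  then show ?thesis
    using sum.reindex_bij_betw[OF h, of y] sum.reindex_bij_betw[OF h, of "\<lambda>i. f (y i)"] by simp
qed

text \<open>
  Every point of \<open>{0..1}\<close> is the midpoint of an endpoint and another point of the interval. As
  \<open>\<phi>\<close> is nonpositive at the endpoints, an upper bound \<open>M\<close> improves to \<open>M / 2\<close>, and by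
  iteration to \<open>M / 2 ^ k\<close> for all \<open>k\<close>.
\<close>

lemma midpoint_convex_bounded_above_nonpos:
  fixes \<phi> :: "real \<Rightarrow> real"
  assumes mid: "\<And>s t. s \<in> {0..1} \<Longrightarrow> t \<in> {0..1} \<Longrightarrow> 2 * \<phi> ((s + t) / 2) \<le> \<phi> s + \<phi> t"
    and "\<phi> 0 \<le> 0" "\<phi> 1 \<le> 0"
    and bdd: "\<And>t. t \<in> {0..1} \<Longrightarrow> \<phi> t \<le> M"
    and t: "t \<in> {0..1}"
  shows "\<phi> t \<le> 0"
proof -
  have bound: "\<phi> t \<le> M / 2 ^ k" if "t \<in> {0..1}" for t k
    using that
  proof (induction k arbitrary: t)
    case 0
    then show ?case using bdd by simp
  next
    case (Suc k)
    show ?case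
    proof (cases "t \<le> 1/2")
      case True
      then have "\<phi> (2 * t) \<le> M / 2 ^ k" using Suc by auto
      then show ?thesis using mid[of 0 "2 * t"] True Suc.prems \<open>\<phi> 0 \<le> 0\<close> by auto
    next
      case False
      then have "\<phi> (2 * t - 1) \<le> M / 2 ^ k" using Suc by auto
      then show ?thesis using mid[of "2 * t - 1" 1] False Suc.prems \<open>\<phi> 1 \<le> 0\<close> by auto
    qed
  qed
  have "(\<lambda>k. M / 2 ^ k) \<longlonglongrightarrow> 0"
    using tendsto_mult_right_zero[OF LIMSEQ_realpow_zero[of "1/2::real"], of M]
    by (simp add: power_divide)
  then show ?thesis
    using bound[OF t] LIMSEQ_le_const by blast
qed

text \<open>
  If \<open>c \<le> f\<close>, W-convexity gives \<open>f \<le> f x + f y - c\<close> on the segment from \<open>x\<close> to \<open>y\<close>.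
  This is where W-convexity is stronger than midpoint convexity.
\<close>

lemma convex_on_if_W_convex_on_bounded_below:
  assumes W: "W_convex_on D f" and low: "\<And>x. x \<in> D \<Longrightarrow> c \<le> f x"
  shows "convex_on D f"
proof
  show conv: "convex D" using W by (simp add: W_convex_on_def)
  fix t :: real and x y assume "0 < t" "t < 1" and xy: "x \<in> D" "y \<in> D"
  define p where "p s = (1 - s) *\<^sub>R x + s *\<^sub>R y" for s :: real
  \<comment> \<open>The excess of \<open>f\<close> over its chord; it vanishes at both endpoints.\<close>
  define \<phi> where "\<phi> s = f (p s) - ((1 - s) * f x + s * f y)" for s
  have pD: "p s \<in> D" if "s \<in> {0..1}" for s
    using convexD[OF conv xy, of "1 - s" s] that by (auto simp: p_def)
  have "\<phi> t \<le> 0"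
  proof (rule midpoint_convex_bounded_above_nonpos[where \<phi> = \<phi> and M = "\<bar>f x\<bar> + \<bar>f y\<bar> + f x + f y - c"])
    show "2 * \<phi> ((s + t) / 2) \<le> \<phi> s + \<phi> t" if "s \<in> {0..1}" "t \<in> {0..1}" for s t
    proof -
      have "(1/2) *\<^sub>R p s + (1/2) *\<^sub>R p t
          = ((1 - s) / 2 + (1 - t) / 2) *\<^sub>R x + (s / 2 + t / 2) *\<^sub>R y"
        by (simp add: p_def scaleR_add_left scaleR_add_right)
      also have "\<dots> = p ((s + t) / 2)"
        by (simp add: p_def add_divide_distrib diff_divide_distrib)
      finally have "p ((s + t) / 2) = (1/2) *\<^sub>R p s + (1/2) *\<^sub>R p t" ..
      then show ?thesis
        using W_convex_on_midpoint[OF W pD[OF that(1)] pD[OF that(2)]]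
        by (simp add: \<phi>_def field_simps)
    qed
    show "\<phi> s \<le> \<bar>f x\<bar> + \<bar>f y\<bar> + f x + f y - c" if s: "s \<in> {0..1}" for s
    proof -
      have "f (s *\<^sub>R x + (1 - s) *\<^sub>R y) + f ((1 - s) *\<^sub>R x + s *\<^sub>R y) \<le> f x + f y"
        using W xy s unfolding W_convex_on_def by blast
      moreover have "c \<le> f (s *\<^sub>R x + (1 - s) *\<^sub>R y)"
        using low convexD[OF conv xy, of s "1 - s"] s by auto
      moreover have "\<bar>(1 - s) * f x\<bar> \<le> \<bar>f x\<bar>" "\<bar>s * f y\<bar> \<le> \<bar>f y\<bar>"
        using s by (auto simp: abs_mult intro!: mult_left_le_one_le)
      ultimately show ?thesis
        unfolding \<phi>_def p_def by linarith
    qed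
    show "t \<in> {0..1}" using \<open>0 < t\<close> \<open>t < 1\<close> by simp
  qed (simp_all add: \<phi>_def p_def)
  then show "f ((1 - t) *\<^sub>R x + t *\<^sub>R y) \<le> (1 - t) * f x + t * f y"
    by (simp add: \<phi>_def p_def)
qed

lemma W_convex_on_compose_affine:
  assumes W: "W_convex_on D f"
    and aff: "\<And>u x y. h ((1 - u) *\<^sub>R x + u *\<^sub>R y) = (1 - u) *\<^sub>R h x + u *\<^sub>R h y"
    and "convex E" "h ` E \<subseteq> D"
  shows "W_convex_on E (\<lambda>x. f (h x))"
  unfolding W_convex_on_def
proof (intro conjI ballI)
  fix x y and t :: real assume "x \<in> E" "y \<in> E" "t \<in> {0..1}"
  then have "f (t *\<^sub>R h x + (1 - t) *\<^sub>R h y) + f ((1 - t) *\<^sub>R h x + t *\<^sub>R h y) \<le> f (h x) + f (h y)"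
    using W assms(4) unfolding W_convex_on_def by blast
  then show "f (h (t *\<^sub>R x + (1 - t) *\<^sub>R y)) + f (h ((1 - t) *\<^sub>R x + t *\<^sub>R y)) \<le> f (h x) + f (h y)"
    using aff[of t x y] aff[of "1 - t" x y] by simp
qed fact

lemma W_convex_on_sum:
  assumes "convex E" "\<And>i. i \<in> I \<Longrightarrow> W_convex_on E (g i)"
  shows "W_convex_on E (\<lambda>x. \<Sum>i\<in>I. g i x)"
  using assms unfolding W_convex_on_def by (auto simp flip: sum.distrib intro!: sum_mono)

section \<open>The cyclic maps of a simplex\<close>

text \<open>
  The cyclic permutations act simply transitively on the indices: shifting \<open>i\<close> by \<open>k\<close> is the same
  as shifting \<open>k\<close> by \<open>i\<close>, and the latter is a bijection in \<open>k\<close>.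
\<close>

lemma sum_cyclic_perms:
  fixes g :: "nat \<Rightarrow> 'b::comm_monoid_add"
  assumes "i \<le> n"
  shows "(\<Sum>\<sigma>\<in>cyclic_perms n. g (\<sigma> i)) = (\<Sum>j\<le>n. g j)"
proof -
  have "inj_on (shift n) {..n}"
  proof (rule inj_onI)
    fix k l assume "k \<in> {..n}" "l \<in> {..n}" "shift n k = shift n l"
    then have "shift n k 0 = shift n l 0" by simp
    with \<open>k \<in> {..n}\<close> \<open>l \<in> {..n}\<close> show "k = l" by (simp add: shift_def)
  qed
  then have "(\<Sum>\<sigma>\<in>cyclic_perms n. g (\<sigma> i)) = (\<Sum>k\<le>n. g (shift n k i))"
    unfolding cyclic_perms_def by (simp add: sum.reindex)
  also have "\<dots> = (\<Sum>k\<le>n. g (shift n i k))"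
    using assms by (intro sum.cong) (auto simp: shift_def add.commute)
  also have "\<dots> = (\<Sum>j\<le>n. g j)"
    using assms by (intro sum.reindex_bij_betw shift_permutes) (auto simp: cyclic_perms_def)
  finally show ?thesis .
qed

lemma card_cyclic_perms: "card (cyclic_perms n) = n + 1"
  using sum_cyclic_perms[of 0 n "\<lambda>_. 1::nat"] by simp

lemma finite_cyclic_perms: "finite (cyclic_perms n)"
  by (simp add: cyclic_perms_def)

lemma perm_map_affine:
  fixes v :: "nat \<Rightarrow> real ^ 'n"
  assumes v: "affinely_independent CARD('n) v" and \<sigma>: "\<sigma> \<in> cyclic_perms CARD('n)"
  shows "perm_map CARD('n) v \<sigma> ((1 - u) *\<^sub>R x + u *\<^sub>R y)
    = (1 - u) *\<^sub>R perm_map CARD('n) v \<sigma> x + u *\<^sub>R perm_map CARD('n) v \<sigma> y"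
proof -
  let ?n = "CARD('n)"
  obtain s where s: "(\<Sum>i\<le>?n. s i) = 1" "x = (\<Sum>i\<le>?n. s i *\<^sub>R v i)"
    using bary_coords_exist[OF v] .
  obtain t where t: "(\<Sum>i\<le>?n. t i) = 1" "y = (\<Sum>i\<le>?n. t i *\<^sub>R v i)"
    using bary_coords_exist[OF v] .
  let ?r = "\<lambda>i. (1 - u) * s i + u * t i"
  have lin: "(1 - u) *\<^sub>R (\<Sum>i\<le>?n. a i *\<^sub>R v i) + u *\<^sub>R (\<Sum>i\<le>?n. c i *\<^sub>R v i)
      = (\<Sum>i\<le>?n. ((1 - u) * a i + u * c i) *\<^sub>R v i)" for a c
    by (simp add: scaleR_sum_right scaleR_add_left sum.distrib)
  have r: "(\<Sum>i\<le>?n. ?r i) = 1"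
    using s t by (simp add: sum.distrib flip: sum_distrib_left)
  have "perm_map ?n v \<sigma> ((1 - u) *\<^sub>R x + u *\<^sub>R y) = (\<Sum>i\<le>?n. ?r (\<sigma> i) *\<^sub>R v i)"
    unfolding s(2) t(2) lin by (rule perm_map_sum[OF v r \<sigma>])
  also have "\<dots> = (1 - u) *\<^sub>R perm_map ?n v \<sigma> x + u *\<^sub>R perm_map ?n v \<sigma> y"
    unfolding s(2) t(2) perm_map_sum[OF v s(1) \<sigma>] perm_map_sum[OF v t(1) \<sigma>] lin ..
  finally show ?thesis .
qed

text \<open>Preservation of affine combinations of two points makes \<open>h\<close> a translate of a linear map.\<close>

lemma continuous_on_affine:
  fixes h :: "'a::euclidean_space \<Rightarrow> 'b::real_normed_vector"
  assumes aff: "\<And>u x y. h ((1 - u) *\<^sub>R x + u *\<^sub>R y) = (1 - u) *\<^sub>R h x + u *\<^sub>R h y"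
  shows "continuous_on A h"
proof -
  have scale: "h (c *\<^sub>R x) - h 0 = c *\<^sub>R (h x - h 0)" for c x
    using aff[of c 0 x] by (simp add: algebra_simps)
  have "h (x + y) - h 0 = (h x - h 0) + (h y - h 0)" for x y
  proof -
    have "h (x + y) - h 0 = 2 *\<^sub>R (h ((1 - 1/2) *\<^sub>R x + (1/2) *\<^sub>R y) - h 0)"
      using scale[of 2 "(1 - 1/2) *\<^sub>R x + (1/2) *\<^sub>R y"] by (simp add: scaleR_add_right)
    also have "\<dots> = (h x - h 0) + (h y - h 0)"
      unfolding aff by (simp add: scaleR_add_right scaleR_diff_right scaleR_2)
    finally show ?thesis .
  qed
  then have "linear (\<lambda>x. h x - h 0)"
    using scale by (intro linearI)
  then have "continuous_on A (\<lambda>x. (h x - h 0) + h 0)"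
    by (intro continuous_intros linear_continuous_on linear_conv_bounded_linear[THEN iffD1])
  then show ?thesis by simp
qed

text \<open>
  In the sum, the coefficient of each vertex is the sum of all coordinates of \<open>x\<close>, which is 1.
  Hence the cyclic images of any point have the barycenter as their mean.
\<close>

lemma sum_perm_map:
  fixes v :: "nat \<Rightarrow> real ^ 'n"
  assumes v: "affinely_independent CARD('n) v"
  shows "(\<Sum>\<sigma>\<in>cyclic_perms CARD('n). perm_map CARD('n) v \<sigma> x) = (\<Sum>i\<le>CARD('n). v i)"
proof -
  let ?n = "CARD('n)"
  obtain t where t: "(\<Sum>i\<le>?n. t i) = 1" "x = (\<Sum>i\<le>?n. t i *\<^sub>R v i)"
    using bary_coords_exist[OF v] .
  have "(\<Sum>\<sigma>\<in>cyclic_perms ?n. perm_map ?n v \<sigma> x)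
      = (\<Sum>\<sigma>\<in>cyclic_perms ?n. \<Sum>i\<le>?n. t (\<sigma> i) *\<^sub>R v i)"
    unfolding t(2) by (intro sum.cong refl perm_map_sum[OF v t(1)])
  also have "\<dots> = (\<Sum>i\<le>?n. (\<Sum>\<sigma>\<in>cyclic_perms ?n. t (\<sigma> i)) *\<^sub>R v i)"
    by (subst sum.swap) (simp add: scaleR_sum_left)
  also have "\<dots> = (\<Sum>i\<le>?n. v i)"
    using t(1) by (intro sum.cong) (auto simp: sum_cyclic_perms)
  finally show ?thesis .
qed

text \<open>
  A cyclic map permutes the vertices, and \<open>f (perm_map n v \<sigma> (v j))\<close> selects the value at the
  vertex with index \<open>i\<close> such that \<open>\<sigma> i = j\<close>. Writing this selection as a sum against the
  coordinates of \<open>v j\<close> reduces the claim to \<open>sum_cyclic_perms\<close>.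
\<close>

lemma sum_perm_map_vertex:
  fixes v :: "nat \<Rightarrow> 'a::real_vector" and f :: "'a \<Rightarrow> real"
  assumes v: "affinely_independent n v" and j: "j \<le> n"
  shows "(\<Sum>\<sigma>\<in>cyclic_perms n. f (perm_map n v \<sigma> (v j))) = (\<Sum>i\<le>n. f (v i))"
proof -
  define e where "e i = (if i = j then 1 else 0 :: real)" for i
  have e: "(\<Sum>i\<le>n. e i) = 1" "v j = (\<Sum>i\<le>n. e i *\<^sub>R v i)"
    using j by (simp_all add: e_def if_distrib[where f="\<lambda>r. r *\<^sub>R _"] cong: if_cong)
  have image: "f (perm_map n v \<sigma> (v j)) = (\<Sum>i\<le>n. e (\<sigma> i) * f (v i))" if \<sigma>: "\<sigma> \<in> cyclic_perms n" for \<sigma>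
  proof -
    obtain l where l: "l \<le> n" "\<sigma> l = j"
      using bij_betw_imp_surj_on[OF shift_permutes[OF \<sigma>]] j by (metis atMost_iff imageE)
    have "e (\<sigma> i) = (if i = l then 1 else 0)" if "i \<le> n" for i
      using bij_betw_imp_inj_on[OF shift_permutes[OF \<sigma>]] l that
      by (auto simp: e_def inj_on_def)
    then have "(\<Sum>i\<le>n. e (\<sigma> i) *\<^sub>R v i) = v l"
      and "(\<Sum>i\<le>n. e (\<sigma> i) * f (v i)) = f (v l)"
      using l(1) sum.delta[of "{..n}" l v] sum.delta[of "{..n}" l "\<lambda>i. f (v i)"]
      by (auto simp: if_distrib[where f="\<lambda>r. r *\<^sub>R _"] if_distrib[where f="\<lambda>r. r * _"]
          cong: if_cong intro: sum.cong)
    then show ?thesis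
      using l perm_map_sum[OF v e(1) \<sigma>] by (simp flip: e(2))
  qed
  have "(\<Sum>\<sigma>\<in>cyclic_perms n. f (perm_map n v \<sigma> (v j)))
      = (\<Sum>i\<le>n. (\<Sum>\<sigma>\<in>cyclic_perms n. e (\<sigma> i)) * f (v i))"
    by (simp add: image sum_distrib_right sum.swap[of _ "{..n}"])
  also have "\<dots> = (\<Sum>i\<le>n. f (v i))"
    using e(1) by (intro sum.cong) (auto simp: sum_cyclic_perms)
  finally show ?thesis .
qed

lemma mem_simplexE:
  fixes v :: "nat \<Rightarrow> 'a::real_vector"
  assumes "affinely_independent n v" "x \<in> convex hull (v ` {..n})"
  obtains t where "\<And>i. i \<le> n \<Longrightarrow> 0 \<le> t i" "(\<Sum>i\<le>n. t i) = 1" "x = (\<Sum>i\<le>n. t i *\<^sub>R v i)"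
proof -
  have inj: "inj_on v {..n}" using assms(1) by (simp add: affinely_independent_def)
  obtain u where "\<And>w. w \<in> v ` {..n} \<Longrightarrow> 0 \<le> u w" "sum u (v ` {..n}) = 1"
    "(\<Sum>w\<in>v ` {..n}. u w *\<^sub>R w) = x"
    using assms(2) by (auto simp: convex_hull_finite)
  then show thesis
    by (intro that[of "u \<circ> v"]) (simp_all add: sum.reindex[OF inj])
qed

lemma perm_map_in_simplex:
  fixes v :: "nat \<Rightarrow> 'a::real_vector"
  assumes v: "affinely_independent n v" and \<sigma>: "\<sigma> \<in> cyclic_perms n"
    and x: "x \<in> convex hull (v ` {..n})"
  shows "perm_map n v \<sigma> x \<in> convex hull (v ` {..n})"
proof -
  obtain t where t: "\<And>i. i \<le> n \<Longrightarrow> 0 \<le> t i" "(\<Sum>i\<le>n. t i) = 1" "x = (\<Sum>i\<le>n. t i *\<^sub>R v i)"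
    using mem_simplexE[OF v x] by blast
  have bij: "bij_betw \<sigma> {..n} {..n}" using shift_permutes[OF \<sigma>] .
  have "(\<Sum>i\<le>n. t (\<sigma> i) *\<^sub>R v i) \<in> convex hull (v ` {..n})"
  proof (intro convex_sum)
    show "(\<Sum>i\<le>n. t (\<sigma> i)) = 1" using sum.reindex_bij_betw[OF bij, of t] t(2) by simp
    show "0 \<le> t (\<sigma> i)" if "i \<in> {..n}" for i using bij_betwE[OF bij] that t(1) by auto
  qed (auto intro: hull_inc)
  then show ?thesis unfolding t(3) perm_map_sum[OF v t(2) \<sigma>] .
qed

section \<open>Averages over a simplex\<close>

lemma measure_simplex_pos:
  fixes v :: "nat \<Rightarrow> real ^ 'n"
  assumes v: "affinely_independent CARD('n) v"
  shows "0 < measure lebesgue (convex hull (v ` {..CARD('n)}))"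
proof -
  let ?n = "CARD('n)" and ?S = "convex hull (v ` {..CARD('n)})"
  have "card (v ` {..?n}) = Suc ?n" using v by (simp add: affinely_independent_def card_image)
  then have "affine hull ?S = UNIV"
    using affine_independent_span_gt[of "v ` {..?n}"] v by (simp add: affinely_independent_def)
  then have "interior ?S \<noteq> {}"
    using rel_interior_interior[of ?S] rel_interior_eq_empty[of ?S] by auto
  then have "\<not> negligible ?S"
    using open_not_negligible[of "interior ?S"] negligible_subset[OF _ interior_subset] by blast
  then show ?thesis
    by (metis negligible_iff_measure0 lmeasurable_compact finite_imp_compact_convex_hull
        finite_imageI finite_atMost measure_nonneg order_le_less)
qed

lemma set_integrable_lebesgue_continuous_compact:
  fixes g :: "'a::euclidean_space \<Rightarrow> real"
  assumes "compact S" "continuous_on S g"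
  shows "set_integrable lebesgue S g"
  using borel_integrable_compact[OF assms]
  by (simp add: set_integrable_def integrable_completion borel_measurable_integrable)

lemma average_bounds:
  fixes g :: "'a::euclidean_space \<Rightarrow> real"
  assumes S: "S \<in> lmeasurable" "0 < measure lebesgue S" and g: "set_integrable lebesgue S g"
    and bounds: "\<And>x. x \<in> S \<Longrightarrow> a \<le> g x" "\<And>x. x \<in> S \<Longrightarrow> g x \<le> c"
  shows "a \<le> 1 / measure lebesgue S * (LINT x:S|lebesgue. g x)"
    and "1 / measure lebesgue S * (LINT x:S|lebesgue. g x) \<le> c"
proof -
  have const: "set_integrable lebesgue S (\<lambda>_. r)" "(LINT x:S|lebesgue. r) = r * measure lebesgue S"
    for r :: real
  proof -
    have "integrable lebesgue (indicat_real S)"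
      using S(1) by (intro integrable_real_indicator) (auto simp: fmeasurable_def)
    then show "set_integrable lebesgue S (\<lambda>_. r)" "(LINT x:S|lebesgue. r) = r * measure lebesgue S"
      by (simp_all add: set_integrable_def set_lebesgue_integral_def)
  qed
  have "a * measure lebesgue S \<le> (LINT x:S|lebesgue. g x)"
    using set_integral_mono[OF const(1)[of a] g] bounds(1) const(2) by simp
  moreover have "(LINT x:S|lebesgue. g x) \<le> c * measure lebesgue S"
    using set_integral_mono[OF g const(1)[of c]] bounds(2) const(2) by simp
  ultimately show "a \<le> 1 / measure lebesgue S * (LINT x:S|lebesgue. g x)"
    and "1 / measure lebesgue S * (LINT x:S|lebesgue. g x) \<le> c"
    using S(2) by (simp_all add: field_simps)
qed

theorem theorem5:
  fixes D S :: "(real ^ 'n) set" and v :: "nat \<Rightarrow> real ^ 'n" and f :: "real ^ 'n \<Rightarrow> real"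
    and n :: nat
  assumes "n = CARD('n)"
    and "open D" and "convex D"
    and "affinely_independent n v" and "S = convex hull (v ` {..n})" and "S \<subseteq> D"
    and "W_convex_on D f"
  shows "set_integrable lebesgue S (\<lambda>x. \<Sum>\<sigma>\<in>cyclic_perms n. f (perm_map n v \<sigma> x)) \<and>
    (real n + 1) * f (barycenter n v)
      \<le> 1 / measure lebesgue S *
          (LINT x:S|lebesgue. (\<Sum>\<sigma>\<in>cyclic_perms n. f (perm_map n v \<sigma> x))) \<and>
    1 / measure lebesgue S *
          (LINT x:S|lebesgue. (\<Sum>\<sigma>\<in>cyclic_perms n. f (perm_map n v \<sigma> x)))
      \<le> (\<Sum>i\<le>n. f (v i))"
proof -
  let ?C = "cyclic_perms n"
  define F where "F x = (\<Sum>\<sigma>\<in>?C. f (perm_map n v \<sigma> x))" for x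
  \<comment> \<open>The largest set on which \<open>F\<close> only evaluates \<open>f\<close> inside \<open>D\<close>. It is open, which yields
    continuity of \<open>F\<close> up to the boundary of \<open>S\<close>.\<close>
  define E where "E = (\<Inter>\<sigma>\<in>?C. perm_map n v \<sigma> -` D)"
  note v = assms(4) and W = assms(7)
  have aff: "perm_map n v \<sigma> ((1 - u) *\<^sub>R x + u *\<^sub>R y)
      = (1 - u) *\<^sub>R perm_map n v \<sigma> x + u *\<^sub>R perm_map n v \<sigma> y" if "\<sigma> \<in> ?C" for \<sigma> u x y
    using perm_map_affine v that unfolding assms(1) by blast
  have "open E"
    unfolding E_def using aff \<open>open D\<close>
    by (intro open_INT finite_cyclic_perms ballI open_vimage continuous_on_affine) auto
  have "convex E"
    unfolding convex_alt E_def using aff \<open>convex D\<close> by (auto simp: convex_alt)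
  have "S \<subseteq> E"
    using perm_map_in_simplex[OF v] assms(5,6) by (auto simp: E_def)
  have lower: "(real n + 1) * f (barycenter n v) \<le> F x" if "x \<in> E" for x
  proof -
    have "?C \<noteq> {}" by (auto simp: cyclic_perms_def)
    then have "real (card ?C) * f ((1 / real (card ?C)) *\<^sub>R (\<Sum>\<sigma>\<in>?C. perm_map n v \<sigma> x)) \<le> F x"
      unfolding F_def using that
      by (intro W_convex_on_Jensen[OF W finite_cyclic_perms]) (auto simp: E_def)
    moreover have "(\<Sum>\<sigma>\<in>?C. perm_map n v \<sigma> x) = (\<Sum>i\<le>n. v i)"
      using sum_perm_map v unfolding assms(1) by blast
    ultimately show ?thesis
      by (simp add: card_cyclic_perms barycenter_def add.commute)
  qed
  have "W_convex_on E F"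
    unfolding F_def using aff
    by (intro W_convex_on_sum W_convex_on_compose_affine[OF W] \<open>convex E\<close>) (auto simp: E_def)
  then have "convex_on E F"
    by (rule convex_on_if_W_convex_on_bounded_below) (rule lower)
  have upper: "F x \<le> (\<Sum>i\<le>n. f (v i))" if xS: "x \<in> S" for x
  proof -
    obtain t where t: "\<And>i. i \<le> n \<Longrightarrow> 0 \<le> t i" "(\<Sum>i\<le>n. t i) = 1" "x = (\<Sum>i\<le>n. t i *\<^sub>R v i)"
      using mem_simplexE[OF v xS[unfolded assms(5)]] by blast
    have "v i \<in> E" if "i \<le> n" for i
    proof -
      have "v i \<in> S" unfolding assms(5) using that by (intro hull_inc) simp
      then show ?thesis using \<open>S \<subseteq> E\<close> by blast
    qed
    then have "F x \<le> (\<Sum>i\<le>n. t i * F (v i))"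
      unfolding t(3) using t(1,2) \<open>convex_on E F\<close> by (intro convex_on_sum) auto
    also have "\<dots> = (\<Sum>i\<le>n. t i * (\<Sum>i\<le>n. f (v i)))"
      unfolding F_def by (intro sum.cong) (auto simp: sum_perm_map_vertex[OF v])
    also have "\<dots> = (\<Sum>i\<le>n. f (v i))"
      unfolding sum_distrib_right[symmetric] t(2) by simp
    finally show ?thesis .
  qed
  have "compact S"
    unfolding assms(5) by (intro finite_imp_compact_convex_hull) simp
  have int: "set_integrable lebesgue S F"
    using convex_on_continuous[OF \<open>open E\<close> \<open>convex_on E F\<close>] \<open>S \<subseteq> E\<close> \<open>compact S\<close>
    by (intro set_integrable_lebesgue_continuous_compact) (auto intro: continuous_on_subset)
  have "0 < measure lebesgue S"
    using measure_simplex_pos v unfolding assms(1,5) by blast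
  note average = average_bounds[OF lmeasurable_compact[OF \<open>compact S\<close>] this int _ upper]
  have "(real n + 1) * f (barycenter n v) \<le> F x" if "x \<in> S" for x
    using lower that \<open>S \<subseteq> E\<close> by blast
  with int average show ?thesis
    unfolding F_def by blast
qed

end
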